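(* Let $1/2<\theta\le1$ and $\mathrm{K}_1(\theta)=\frac12\left(\frac2\theta\right)^\theta(2\theta-1)^{\theta-1/2}$. The inequality $$u(0)^2\le\mathrm{K}_1(\theta)\,\|u\|^{2\theta}\,\|\mathrm{D}u\|^{2(1-\theta)},\qquad u\in l^2(\mathbb{Z})$$ (which holds, with sharp constant) is equivalent to the inequality $$\left(\int_0^{2\pi}g(x)\,dx\right)^2\le2\pi\,\mathrm{K}_1(\theta)\left(\int_0^{2\pi}g(x)^2dx\right)^\theta\left(\int_0^{2\pi}4\sin^2\tfrac x2\,g(x)^2dx\right)^{1-\theta}$$ for $g\in L_2(0,2\pi)$; in particular the latter inequality holds for all $g\in L_2(0,2\pi)$. In the limiting case, the inequality $$u(0)^2\le\frac12\sqrt{4-\frac{\|\mathrm{D}u\|^2}{\|u\|^2}}\;\|u\|\,\|\mathrm{D}u\|,\qquad 0\ne u\in l^2(\mathbb{Z})$$ (which holds) is equivalent to the inequality $$\left(\int_0^{2\pi}g(x)\,dx\right)^2\le\pi\sqrt{4-\frac{\int_0^{2\pi}4\sin^2\frac x2\,g(x)^2dx}{\int_0^{2\pi}g(x)^2dx}}\left(\int_0^{2\pi}g(x)^2dx\right)^{1/2}\left(\int_0^{2\pi}4\sin^2\tfrac x2\,g(x)^2dx\right)^{1/2}$$ for nonzero $g\in L_2(0,2\pi)$, so that the latter inequality also holds.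
   Context: Sequences $u$ and functions $g$ are real-valued. For $u\in l^2(\mathbb{Z})$: $\mathrm{D}u(n)=u(n+1)-u(n)$, $\|u\|^2=\sum_ku(k)^2$, $\|\mathrm{D}u\|^2=\sum_k(\mathrm{D}u(k))^2$. Convention: $0^0=1$. *)

theory Defs
  imports "HOL-Analysis.Analysis"
begin

definition l2 :: "(int \<Rightarrow> real) set"
  where "l2 = {u. (\<lambda>k. (u k)\<^sup>2) summable_on UNIV}"

definition l2_norm :: "(int \<Rightarrow> real) \<Rightarrow> real"
  where "l2_norm u = sqrt (\<Sum>\<^sub>\<infinity>k. (u k)\<^sup>2)"

definition D :: "(int \<Rightarrow> real) \<Rightarrow> int \<Rightarrow> real"
  where "D u n = u (n + 1) - u n"

text \<open>The library has \<open>0 powr 0 = 0\<close>; the convention here is \<open>rpow 0 0 = 1\<close>.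
  Otherwise the two functions agree.\<close>

definition rpow :: "real \<Rightarrow> real \<Rightarrow> real"
  where "rpow x a = (if a = 0 then 1 else x powr a)"

definition K1 :: "real \<Rightarrow> real"
  where "K1 \<theta> = 1 / 2 * rpow (2 / \<theta>) \<theta> * rpow (2 * \<theta> - 1) (\<theta> - 1 / 2)"

abbreviation M :: "real measure"
  where "M \<equiv> lebesgue_on {0<..<2 * pi}"

text \<open>Elements of \<open>L2\<close> are functions rather than classes modulo null sets; accordingly,
  \<open>g\<close> is nonzero iff it does not vanish almost everywhere.\<close>

definition L2 :: "(real \<Rightarrow> real) set"
  where "L2 = {g \<in> borel_measurable M. integrable M (\<lambda>x. (g x)\<^sup>2)}"

definition sequence_ineq :: "real \<Rightarrow> real \<Rightarrow> bool"
  where "sequence_ineq \<theta> C \<longleftrightarrow>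
    (\<forall>u\<in>l2. (u 0)\<^sup>2 \<le> C * rpow (l2_norm u) (2 * \<theta>) * rpow (l2_norm (D u)) (2 * (1 - \<theta>)))"

definition integral_ineq :: "real \<Rightarrow> real \<Rightarrow> bool"
  where "integral_ineq \<theta> C \<longleftrightarrow>
    (\<forall>g\<in>L2. (\<integral>x. g x \<partial>M)\<^sup>2
      \<le> C * rpow (\<integral>x. (g x)\<^sup>2 \<partial>M) \<theta>
          * rpow (\<integral>x. 4 * (sin (x / 2))\<^sup>2 * (g x)\<^sup>2 \<partial>M) (1 - \<theta>))"

definition limit_sequence_ineq :: bool
  where "limit_sequence_ineq \<longleftrightarrow>
    (\<forall>u\<in>l2. u \<noteq> (\<lambda>_. 0) \<longrightarrow>
      (u 0)\<^sup>2 \<le> 1 / 2 * sqrt (4 - (l2_norm (D u))\<^sup>2 / (l2_norm u)\<^sup>2)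
                  * l2_norm u * l2_norm (D u))"

definition limit_integral_ineq :: bool
  where "limit_integral_ineq \<longleftrightarrow>
    (\<forall>g\<in>L2. \<not> (AE x in M. g x = 0) \<longrightarrow>
      (\<integral>x. g x \<partial>M)\<^sup>2
        \<le> pi * sqrt (4 - (\<integral>x. 4 * (sin (x / 2))\<^sup>2 * (g x)\<^sup>2 \<partial>M) / (\<integral>x. (g x)\<^sup>2 \<partial>M))
            * rpow (\<integral>x. (g x)\<^sup>2 \<partial>M) (1 / 2)
            * rpow (\<integral>x. 4 * (sin (x / 2))\<^sup>2 * (g x)\<^sup>2 \<partial>M) (1 / 2))"

end

theory Submission
  imports Defs
begin

text \<open>Write \<open>a = \<parallel>u\<parallel>\<^sup>2\<close> and \<open>b = \<parallel>D u\<parallel>\<^sup>2\<close>, or \<open>a\<close> and \<open>b\<close> for the two integrals. Both limiting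
  inequalities are proved directly, so that the equivalences are immediate. For sequences,
  \<open>4 a - b\<close> is the squared norm of \<open>S u(n) = u(n + 1) + u(n)\<close>; telescoping
  \<open>u(n + 1)\<^sup>2 - u(n)\<^sup>2 = S u(n) D u(n)\<close> from both ends to the origin and applying Cauchy-Schwarz
  gives \<open>2 u(0)\<^sup>2 \<le> \<parallel>S u\<parallel> \<parallel>D u\<parallel>\<close>. For integrals, \<open>4 a - b\<close> is the integral of
  \<open>4 cos\<^sup>2(x/2) g(x)\<^sup>2\<close>, and one applies Cauchy-Schwarz with the weight
  \<open>t sin\<^sup>2(x/2) + cos\<^sup>2(x/2) / t\<close>, whose inverse has integral \<open>2 \<pi>\<close> for every \<open>t > 0\<close>, and
  optimises \<open>t\<close>. The inequalities with exponent \<open>\<theta>\<close> follow since \<open>4 K\<^sub>1(\<theta>)\<^sup>2\<close> is the maximum of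
  \<open>(4 - d) d\<^bsup>2\<theta>-1\<^esup>\<close> over \<open>0 \<le> d \<le> 4\<close>, and \<open>u(n) = q\<^bsup>\<bar>n\<bar>\<^esup>\<close> attains equality for a suitable
  \<open>q\<close>.\<close>

lemma le_geometric_mean_of_weighted_sums:
  fixes X A B :: real
  assumes "0 \<le> A" "0 \<le> B" and X: "\<And>t. 0 < t \<Longrightarrow> X \<le> t * A + B / t"
  shows "X \<le> 2 * sqrt (A * B)"
proof -
  have bound: "X \<le> 2 * sqrt ((A + e) * (B + e))" if "0 < e" for e
  proof -
    define a b where "a = sqrt (A + e)" and "b = sqrt (B + e)"
    have pos: "0 < a" "0 < b" and sq: "a\<^sup>2 = A + e" "b\<^sup>2 = B + e"
      using that assms by (auto simp: a_def b_def)
    have "X \<le> (b / a) * A + B / (b / a)"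
      using pos by (intro X) simp
    also have "\<dots> \<le> (b / a) * a\<^sup>2 + b\<^sup>2 / (b / a)"
      using pos sq that by (intro add_mono mult_left_mono divide_right_mono) auto
    also have "\<dots> = 2 * (a * b)"
      using pos by (simp add: power2_eq_square)
    finally show ?thesis by (simp add: a_def b_def real_sqrt_mult)
  qed
  have "((\<lambda>e. 2 * sqrt ((A + e) * (B + e))) \<longlongrightarrow> 2 * sqrt ((A + 0) * (B + 0))) (at_right 0)"
    by (intro tendsto_intros)
  then have "X \<le> 2 * sqrt ((A + 0) * (B + 0))"
    by (rule tendsto_lowerbound)
       (auto intro!: eventually_mono[OF eventually_at_right_less[of 0]] bound)
  then show ?thesis by simp
qed

subsection \<open>The constant\<close>

lemma rpow_pos: "0 < x \<Longrightarrow> rpow x a = x powr a"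
  by (simp add: rpow_def)

lemma rpow_nonneg: "0 \<le> rpow x a"
  by (simp add: rpow_def)

lemma rpow_half: "0 \<le> x \<Longrightarrow> rpow x (1 / 2) = sqrt x"
  by (simp add: rpow_def powr_half_sqrt)

lemma rpow_sqrt: "0 \<le> x \<Longrightarrow> rpow (sqrt x) (2 * a) = rpow x a"
  by (auto simp: rpow_def powr_half_sqrt[symmetric] powr_powr)

lemma K1_powr:
  assumes "1 / 2 < \<theta>"
  shows "K1 \<theta> = 1 / 2 * (2 / \<theta>) powr \<theta> * (2 * \<theta> - 1) powr (\<theta> - 1 / 2)"
  using assms by (simp add: K1_def rpow_pos)

lemma K1_pos: "1 / 2 < \<theta> \<Longrightarrow> 0 < K1 \<theta>"
  by (simp add: K1_powr)

text \<open>Weighted arithmetic-geometric mean: \<open>ln x \<le> x - 1\<close> is applied to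
  \<open>4 * a - b\<close> and \<open>b\<close>, each divided by its value at the maximiser, with
  weights 1 and \<open>2 * \<theta> - 1\<close>.\<close>

lemma limit_bound_le_K1:
  assumes \<theta>: "1 / 2 < \<theta>" "\<theta> \<le> 1" and "0 \<le> a" "0 \<le> b" "b \<le> 4 * a"
  shows "1 / 2 * sqrt ((4 * a - b) * b) \<le> K1 \<theta> * rpow a \<theta> * rpow b (1 - \<theta>)"
proof (cases "0 < b \<and> b < 4 * a")
  case False
  \<comment> \<open>Here \<open>b = 0\<close> or \<open>b = 4 * a\<close>. The case
    \<open>b = 0\<close>, \<open>\<theta> = 1\<close>, where \<open>rpow\<close> and
    \<open>powr\<close> differ, falls here.\<close>
  then have "sqrt ((4 * a - b) * b) = 0"
    using assms by auto
  moreover have "0 \<le> K1 \<theta> * rpow a \<theta> * rpow b (1 - \<theta>)"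
    using K1_pos[OF \<theta>(1)] by (simp add: rpow_nonneg)
  ultimately show ?thesis by (simp only:)
next
  case True
  then have pos: "0 < a" "0 < b" "0 < 4 * a - b" "0 < \<theta>" "0 < 2 * \<theta> - 1"
    using \<theta> by auto
  have "ln ((4 * a - b) * \<theta> / (2 * a)) \<le> (4 * a - b) * \<theta> / (2 * a) - 1"
    using pos by (intro ln_le_minus_one) simp
  moreover have "(2 * \<theta> - 1) * ln (b * \<theta> / (2 * a * (2 * \<theta> - 1)))
      \<le> (2 * \<theta> - 1) * (b * \<theta> / (2 * a * (2 * \<theta> - 1)) - 1)"
    using pos by (intro mult_left_mono ln_le_minus_one) simp_all
  moreover have "(4 * a - b) * \<theta> / (2 * a) - 1
      + (2 * \<theta> - 1) * (b * \<theta> / (2 * a * (2 * \<theta> - 1)) - 1) = 0"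
    using pos by (simp add: field_simps)
  ultimately have "ln ((4 * a - b) * \<theta> / (2 * a))
      + (2 * \<theta> - 1) * ln (b * \<theta> / (2 * a * (2 * \<theta> - 1))) \<le> 0"
    by linarith
  \<comment> \<open>Half of this left side is the logarithm of the claimed left side minus that of
    the right side.\<close>
  then have le: "(ln (4 * a - b) + ln \<theta> - ln 2 - ln a)
      + (2 * \<theta> - 1) * (ln b + ln \<theta> - ln 2 - ln a - ln (2 * \<theta> - 1)) \<le> 0"
    using pos by (simp only: ln_mult_pos ln_divide_pos mult_pos_pos zero_less_numeral diff_diff_eq)
  have "ln (1 / 2 * sqrt ((4 * a - b) * b)) = (ln (4 * a - b) + ln b) / 2 - ln 2"
    using pos by (simp add: ln_mult ln_div ln_sqrt)
  moreover have "ln (K1 \<theta> * a powr \<theta> * b powr (1 - \<theta>)) =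
      - ln 2 + \<theta> * (ln 2 - ln \<theta>) + (\<theta> - 1 / 2) * ln (2 * \<theta> - 1) + \<theta> * ln a + (1 - \<theta>) * ln b"
    using pos \<theta> by (simp add: K1_powr ln_mult ln_div ln_powr)
  ultimately have "ln (1 / 2 * sqrt ((4 * a - b) * b)) \<le> ln (K1 \<theta> * a powr \<theta> * b powr (1 - \<theta>))"
    using le by (simp add: algebra_simps)
  then have "1 / 2 * sqrt ((4 * a - b) * b) \<le> K1 \<theta> * a powr \<theta> * b powr (1 - \<theta>)"
    using pos K1_pos[OF \<theta>(1)] by (subst (asm) ln_le_cancel_iff) auto
  then show ?thesis
    using pos by (simp add: rpow_pos)
qed

text \<open>The maximiser of \<open>(4 - d) d\<^bsup>2\<theta>-1\<^esup>\<close> is \<open>d = 2 (2 \<theta> - 1) / \<theta>\<close>.\<close>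

lemma limit_bound_eq_K1:
  assumes \<theta>: "1 / 2 < \<theta>" and "0 < a" and b: "\<theta> * b = 2 * (2 * \<theta> - 1) * a"
  shows "1 / 2 * sqrt ((4 * a - b) * b) = K1 \<theta> * a powr \<theta> * b powr (1 - \<theta>)"
proof -
  have b': "b = 2 * (2 * \<theta> - 1) * a / \<theta>"
    using b \<theta> by (simp add: field_simps)
  have pos: "0 < \<theta>" "0 < 2 * \<theta> - 1" "0 < b" using \<theta> \<open>0 < a\<close> by (auto simp: b')
  have "4 * a - b = 2 * a / \<theta>"
    using pos by (simp add: b' field_simps)
  then have L: "ln (1 / 2 * sqrt ((4 * a - b) * b)) = (ln 2 + ln a - ln \<theta> + ln b) / 2 - ln 2"
    using pos \<open>0 < a\<close> by (simp add: ln_mult ln_div ln_sqrt)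
  have lb: "ln b = ln 2 + ln (2 * \<theta> - 1) + ln a - ln \<theta>"
    unfolding b' using pos \<open>0 < a\<close>
    by (simp only: ln_mult_pos ln_divide_pos mult_pos_pos zero_less_numeral)
  have R: "ln (K1 \<theta> * a powr \<theta> * b powr (1 - \<theta>)) =
      - ln 2 + \<theta> * (ln 2 - ln \<theta>) + (\<theta> - 1 / 2) * ln (2 * \<theta> - 1) + \<theta> * ln a + (1 - \<theta>) * ln b"
    using pos \<theta> \<open>0 < a\<close> by (simp add: K1_powr ln_mult ln_div ln_powr)
  have "ln (1 / 2 * sqrt ((4 * a - b) * b)) = ln (K1 \<theta> * a powr \<theta> * b powr (1 - \<theta>))"
    unfolding L R lb by (simp add: field_simps)
  then show ?thesis
    using pos K1_pos[OF \<theta>] \<open>0 < a\<close> \<open>4 * a - b = 2 * a / \<theta>\<close> by (subst (asm) ln_inj_iff) auto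
qed

subsection \<open>Sequences\<close>

lemma bij_add_int: "bij (\<lambda>n::int. n + c)"
  by (rule bij_betw_byWitness[where f' = "\<lambda>n. n - c"]) auto

text \<open>Parallelogram law for \<open>u (n + 1)\<close> and \<open>u n\<close>, summed over all
  integers. Shift invariance gives the factor 4, and the pointwise identity supplies the summable
  majorant.\<close>

lemma l2_parallelogram:
  assumes "u \<in> l2"
  shows "(\<lambda>n. (D u n)\<^sup>2) summable_on UNIV" "(\<lambda>n. (u (n + 1) + u n)\<^sup>2) summable_on UNIV"
    and "(\<Sum>\<^sub>\<infinity>n. (u (n + 1) + u n)\<^sup>2) = 4 * (\<Sum>\<^sub>\<infinity>n. (u n)\<^sup>2) - (\<Sum>\<^sub>\<infinity>n. (D u n)\<^sup>2)"
proof -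
  have u: "(\<lambda>n. (u n)\<^sup>2) summable_on UNIV"
    using assms by (simp add: l2_def)
  have su: "(\<lambda>n. (u (n + 1))\<^sup>2) summable_on UNIV"
    using u summable_on_reindex_bij_betw[OF bij_add_int[of 1], of "\<lambda>n. (u n)\<^sup>2"] by simp
  have shift: "(\<Sum>\<^sub>\<infinity>n. (u (n + 1))\<^sup>2) = (\<Sum>\<^sub>\<infinity>n. (u n)\<^sup>2)"
    using infsum_reindex_bij_betw[OF bij_add_int[of 1], of "\<lambda>n. (u n)\<^sup>2"] by simp
  have sum: "(\<lambda>n. 2 * ((u (n + 1))\<^sup>2 + (u n)\<^sup>2)) summable_on UNIV"
    by (intro summable_on_cmult_right summable_on_add u su)
  have id: "(D u n)\<^sup>2 + (u (n + 1) + u n)\<^sup>2 = 2 * ((u (n + 1))\<^sup>2 + (u n)\<^sup>2)" for n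
    by (simp add: D_def power2_eq_square algebra_simps)
  show D: "(\<lambda>n. (D u n)\<^sup>2) summable_on UNIV"
    by (rule summable_on_comparison_test[OF sum]) (simp_all only: id[symmetric], simp_all)
  show S: "(\<lambda>n. (u (n + 1) + u n)\<^sup>2) summable_on UNIV"
    by (rule summable_on_comparison_test[OF sum]) (simp_all only: id[symmetric], simp_all)
  have "(\<Sum>\<^sub>\<infinity>n. (D u n)\<^sup>2) + (\<Sum>\<^sub>\<infinity>n. (u (n + 1) + u n)\<^sup>2) = (\<Sum>\<^sub>\<infinity>n. 2 * ((u (n + 1))\<^sup>2 + (u n)\<^sup>2))"
    by (simp add: infsum_add[OF D S, symmetric] id)
  also have "\<dots> = 4 * (\<Sum>\<^sub>\<infinity>n. (u n)\<^sup>2)"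
    unfolding infsum_cmult_right' infsum_add[OF su u] shift by simp
  finally show "(\<Sum>\<^sub>\<infinity>n. (u (n + 1) + u n)\<^sup>2) = 4 * (\<Sum>\<^sub>\<infinity>n. (u n)\<^sup>2) - (\<Sum>\<^sub>\<infinity>n. (D u n)\<^sup>2)"
    by simp
qed

text \<open>Removes the boundary terms of the telescoping at both ends, with
  \<open>h N = int N\<close> and \<open>h N = - int N\<close>.\<close>

lemma l2_tendsto_zero:
  assumes "u \<in> l2" and "inj h"
  shows "(\<lambda>N::nat. (u (h N))\<^sup>2) \<longlonglongrightarrow> 0"
proof -
  have "(\<lambda>n. (u n)\<^sup>2) summable_on range h"
    using assms(1) by (auto simp: l2_def intro: summable_on_subset_banach)
  then have "(\<lambda>N. (u (h N))\<^sup>2) summable_on UNIV"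
    by (simp add: summable_on_reindex[OF assms(2)] o_def)
  then show ?thesis
    by (intro summable_LIMSEQ_zero summable_on_imp_summable)
qed

text \<open>Finite form of the telescoping, with boundary terms retained. The two halves enter with
  opposite signs; absolute values merge them into one sum.\<close>

lemma two_sided_telescope:
  "2 * (u 0)\<^sup>2 \<le> (u (int N))\<^sup>2 + (u (- int N))\<^sup>2
     + (\<Sum>n\<in>{- int N..<int N}. \<bar>(u (n + 1) + u n) * D u n\<bar>)" for u :: "int \<Rightarrow> real"
proof (induction N)
  case (Suc N)
  let ?f = "\<lambda>n. \<bar>(u (n + 1) + u n) * D u n\<bar>"
  have f: "?f n = \<bar>(u (n + 1))\<^sup>2 - (u n)\<^sup>2\<bar>" for n
    by (simp add: D_def power2_eq_square algebra_simps)
  \<comment> \<open>The term at \<open>n\<close> joins \<open>n\<close> to \<open>n + 1\<close>,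
    hence the half-open range: the induction step adds the terms at \<open>- int N - 1\<close> and
    \<open>int N\<close>.\<close>
  have "{- int (Suc N)..<int (Suc N)} = insert (- int N - 1) (insert (int N) {- int N..<int N})"
    by auto
  then have "sum ?f {- int (Suc N)..<int (Suc N)}
      = ?f (- int N - 1) + (?f (int N) + sum ?f {- int N..<int N})"
    by simp
  moreover have "?f (- int N - 1) = \<bar>(u (- int N))\<^sup>2 - (u (- int (Suc N)))\<^sup>2\<bar>"
  proof -
    have "- int (Suc N) = - int N - 1" by simp
    then show ?thesis unfolding f by (simp only: diff_add_cancel)
  qed
  moreover have "?f (int N) = \<bar>(u (int (Suc N)))\<^sup>2 - (u (int N))\<^sup>2\<bar>"
    unfolding f by (simp add: add.commute)
  ultimately show ?case using Suc by linarith
qed simp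

lemma young_abs_mult: "\<bar>x * y\<bar> \<le> (t * y\<^sup>2 + x\<^sup>2 / t) / 2" if "0 < t" for x y t :: real
proof -
  have "0 \<le> (t * \<bar>y\<bar> - \<bar>x\<bar>)\<^sup>2 / t"
    using that by simp
  also have "\<dots> = t * y\<^sup>2 + x\<^sup>2 / t - 2 * \<bar>x * y\<bar>"
    using that by (simp add: field_simps power2_eq_square abs_mult)
  finally show ?thesis by simp
qed

text \<open>Cauchy-Schwarz enters as Young's inequality with a parameter \<open>t\<close>: it passes
  through finite sums term by term, and \<open>t\<close> is optimised only after the limit in
  \<open>N\<close>.\<close>

lemma sequence_bound:
  assumes "u \<in> l2"
  defines "a \<equiv> (\<Sum>\<^sub>\<infinity>n. (u n)\<^sup>2)" and "b \<equiv> (\<Sum>\<^sub>\<infinity>n. (D u n)\<^sup>2)"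
  shows "0 \<le> a" "0 \<le> b" "b \<le> 4 * a" "(u 0)\<^sup>2 \<le> 1 / 2 * sqrt ((4 * a - b) * b)"
proof -
  let ?S = "\<lambda>n. u (n + 1) + u n"
  note par = l2_parallelogram[OF assms(1), folded a_def b_def]
  show "0 \<le> a" "0 \<le> b"
    by (auto simp: a_def b_def intro: infsum_nonneg)
  have "0 \<le> (\<Sum>\<^sub>\<infinity>n. (?S n)\<^sup>2)"
    by (auto intro: infsum_nonneg)
  then show ba: "b \<le> 4 * a"
    by (simp add: par)
  have bound: "4 * (u 0)\<^sup>2 \<le> t * b + (4 * a - b) / t" if "0 < t" for t
  proof -
    define R where "R = t * b + (4 * a - b) / t"
    have "4 * (u 0)\<^sup>2 - R \<le> 2 * ((u (int N))\<^sup>2 + (u (- int N))\<^sup>2)" for N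
    proof -
      have "(\<Sum>n\<in>{- int N..<int N}. \<bar>?S n * D u n\<bar>)
          \<le> (\<Sum>n\<in>{- int N..<int N}. (t * (D u n)\<^sup>2 + (?S n)\<^sup>2 / t) / 2)"
        using that by (intro sum_mono young_abs_mult)
      also have "\<dots> = (t * (\<Sum>n\<in>{- int N..<int N}. (D u n)\<^sup>2)
          + (\<Sum>n\<in>{- int N..<int N}. (?S n)\<^sup>2) / t) / 2"
        by (simp add: sum.distrib sum_distrib_left sum_divide_distrib add_divide_distrib)
      also have "\<dots> \<le> (t * b + (4 * a - b) / t) / 2"
        unfolding par(3)[symmetric] unfolding b_def using that par(1,2)
        by (intro divide_right_mono add_mono mult_left_mono finite_sum_le_infsum) auto
      finally have "(\<Sum>n\<in>{- int N..<int N}. \<bar>?S n * D u n\<bar>) \<le> R / 2"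
        by (simp only: R_def)
      from order_trans[OF two_sided_telescope[of u N] add_left_mono[OF this]]
      show ?thesis by simp
    qed
    \<comment> \<open>The other side of the estimate does not involve \<open>N\<close>, so the limit
      removes the boundary terms.\<close>
    moreover have "(\<lambda>N. 2 * ((u (int N))\<^sup>2 + (u (- int N))\<^sup>2)) \<longlonglongrightarrow> 2 * (0 + 0)"
      by (intro tendsto_intros l2_tendsto_zero[OF assms(1)]) (auto simp: inj_def)
    ultimately have "4 * (u 0)\<^sup>2 - R \<le> 2 * (0 + 0)"
      by (intro tendsto_lowerbound[OF _ _ sequentially_bot]) auto
    then show ?thesis by (simp add: R_def)
  qed
  have "4 * (u 0)\<^sup>2 \<le> 2 * sqrt (b * (4 * a - b))"
    using \<open>0 \<le> b\<close> ba bound by (intro le_geometric_mean_of_weighted_sums) auto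
  then show "(u 0)\<^sup>2 \<le> 1 / 2 * sqrt ((4 * a - b) * b)"
    by (simp add: mult.commute)
qed

lemma sequence_ineq_iff:
  "sequence_ineq \<theta> C \<longleftrightarrow> (\<forall>u\<in>l2. (u 0)\<^sup>2 \<le>
     C * rpow (\<Sum>\<^sub>\<infinity>n. (u n)\<^sup>2) \<theta> * rpow (\<Sum>\<^sub>\<infinity>n. (D u n)\<^sup>2) (1 - \<theta>))"
  unfolding sequence_ineq_def l2_norm_def
  by (subst (1 2) rpow_sqrt) (auto intro: infsum_nonneg)

lemma sequence_ineq_K1:
  assumes "1 / 2 < \<theta>" "\<theta> \<le> 1"
  shows "sequence_ineq \<theta> (K1 \<theta>)"
  unfolding sequence_ineq_iff
  using sequence_bound limit_bound_le_K1[OF assms] by (blast intro: order_trans)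

text \<open>Links the quotient form of the limiting inequalities to the form proved in
  \<open>sequence_bound\<close> and \<open>integral_bound\<close>. If \<open>a = 0\<close>, then
  \<open>b = 0\<close> and both sides vanish.\<close>

lemma sqrt_diff_divide_mult:
  assumes "0 \<le> a" "0 \<le> b" "b \<le> 4 * a"
  shows "sqrt (4 - b / a) * sqrt a * sqrt b = sqrt ((4 * a - b) * b)"
proof (cases "a = 0")
  case False
  then have "(4 - b / a) * a = 4 * a - b" by (simp add: field_simps)
  then show ?thesis by (simp add: real_sqrt_mult[symmetric])
qed (use assms in simp)

lemma limit_sequence_ineq: "limit_sequence_ineq"
  unfolding limit_sequence_ineq_def
proof (intro ballI impI)
  fix u assume u: "u \<in> l2"
  note sb = sequence_bound[OF u]
  then show "(u 0)\<^sup>2 \<le> 1 / 2 * sqrt (4 - (l2_norm (D u))\<^sup>2 / (l2_norm u)\<^sup>2) * l2_norm u * l2_norm (D u)"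
    using sqrt_diff_divide_mult[OF sb(1-3)] by (simp add: l2_norm_def)
qed

section \<open>Sharpness of the constant: two-sided geometric sequences\<close>

lemma has_sum_int:
  fixes f :: "int \<Rightarrow> real"
  assumes nonneg: "\<And>n. 0 \<le> f n"
    and "(\<lambda>n. f (int n)) sums x" "(\<lambda>n. f (- int n - 1)) sums y"
  shows "(f has_sum (x + y)) UNIV"
proof -
  have "(f has_sum x) (range int)"
    using sums_nonneg_imp_has_sum[OF assms(2)] nonneg by (simp add: has_sum_reindex o_def)
  moreover have "(f has_sum y) (range (\<lambda>n. - int n - 1))"
    using sums_nonneg_imp_has_sum[OF assms(3)] nonneg by (simp add: has_sum_reindex o_def inj_def)
  ultimately have "(f has_sum (x + y)) (range int \<union> range (\<lambda>n. - int n - 1))"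
    by (rule has_sum_Un_disjoint) auto
  moreover have "range int \<union> range (\<lambda>n. - int n - 1) = UNIV"
  proof -
    have "k \<in> range int \<union> range (\<lambda>n. - int n - 1)" for k
    proof (cases "0 \<le> k")
      case True
      then have "k = int (nat k)" by simp
      then show ?thesis by blast
    next
      case False
      then have "k = - int (nat (- k - 1)) - 1" by simp
      then show ?thesis by blast
    qed
    then show ?thesis by blast
  qed
  ultimately show ?thesis by simp
qed

text \<open>The case \<open>q = 0\<close> is included, with \<open>0 ^ 0 = 1\<close>: the unit
  sequence at the origin, which is the extremal for \<open>\<theta> = 1\<close>.\<close>

lemma geometric_sequence_sums:
  fixes q :: real
  assumes q: "0 \<le> q" "q < 1"
  defines "u \<equiv> \<lambda>n::int. q ^ nat \<bar>n\<bar>"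
  shows "((\<lambda>n. (u n)\<^sup>2) has_sum ((1 + q\<^sup>2) / (1 - q\<^sup>2))) UNIV"
    and "((\<lambda>n. (D u n)\<^sup>2) has_sum (2 * (1 - q)\<^sup>2 / (1 - q\<^sup>2))) UNIV"
proof -
  have "q\<^sup>2 < 1" using q by (simp add: power_less_one_iff abs_square_less_1)
  then have geo: "(\<lambda>n. c * (q\<^sup>2) ^ n) sums (c / (1 - q\<^sup>2))" for c
    using sums_mult[OF geometric_sums[of "q\<^sup>2"], of c] by simp
  have nat: "nat \<bar>int n + 1\<bar> = Suc n" "nat \<bar>- int n - 1\<bar> = Suc n" for n by auto
  have "((\<lambda>n. (u n)\<^sup>2) has_sum (1 / (1 - q\<^sup>2) + q\<^sup>2 / (1 - q\<^sup>2))) UNIV"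
  proof (rule has_sum_int)
    show "(\<lambda>n. (u (int n))\<^sup>2) sums (1 / (1 - q\<^sup>2))"
      using geo[of 1] by (simp add: u_def power_mult[symmetric] mult.commute)
    have "(u (- int n - 1))\<^sup>2 = q\<^sup>2 * (q\<^sup>2) ^ n" for n
      unfolding u_def nat by (simp add: power_mult[symmetric] power_mult_distrib mult.commute)
    then show "(\<lambda>n. (u (- int n - 1))\<^sup>2) sums (q\<^sup>2 / (1 - q\<^sup>2))"
      using geo[of "q\<^sup>2"] by simp
  qed simp
  then show "((\<lambda>n. (u n)\<^sup>2) has_sum ((1 + q\<^sup>2) / (1 - q\<^sup>2))) UNIV"
    by (simp add: add_divide_distrib)
  have D: "(q ^ Suc n - q ^ n)\<^sup>2 = (1 - q)\<^sup>2 * (q\<^sup>2) ^ n" for n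
  proof -
    have "q ^ Suc n - q ^ n = - ((1 - q) * q ^ n)" by (simp add: algebra_simps)
    then show ?thesis by (simp add: power_mult_distrib power_mult[symmetric] mult.commute)
  qed
  have "((\<lambda>n. (D u n)\<^sup>2) has_sum ((1 - q)\<^sup>2 / (1 - q\<^sup>2) + (1 - q)\<^sup>2 / (1 - q\<^sup>2))) UNIV"
  proof (rule has_sum_int)
    have "(D u (int n))\<^sup>2 = (1 - q)\<^sup>2 * (q\<^sup>2) ^ n" for n
      unfolding u_def D_def nat by (simp only: D nat_int abs_of_nat)
    then show "(\<lambda>n. (D u (int n))\<^sup>2) sums ((1 - q)\<^sup>2 / (1 - q\<^sup>2))"
      using geo by simp
    \<comment> \<open>Reflection: since \<open>u\<close> is even, the difference at
      \<open>- int n - 1\<close> is minus the one at \<open>int n\<close>.\<close>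
    have "(D u (- int n - 1))\<^sup>2 = (q ^ Suc n - q ^ n)\<^sup>2" for n
      unfolding u_def D_def nat by (simp add: power2_commute)
    then show "(\<lambda>n. (D u (- int n - 1))\<^sup>2) sums ((1 - q)\<^sup>2 / (1 - q\<^sup>2))"
      using geo by (simp only: D)
  qed simp
  then show "((\<lambda>n. (D u n)\<^sup>2) has_sum (2 * (1 - q)\<^sup>2 / (1 - q\<^sup>2))) UNIV"
    by (simp add: add_divide_distrib[symmetric])
qed

lemma sequence_ineq_sharp:
  assumes \<theta>: "1 / 2 < \<theta>" "\<theta> \<le> 1" and C: "sequence_ineq \<theta> C"
  shows "K1 \<theta> \<le> C"
proof -
  \<comment> \<open>the equation \<open>b / a = 2 (2 \<theta> - 1) / \<theta>\<close> for \<open>u(n) = q\<^bsup>\<bar>n\<bar>\<^esup>\<close>\<close>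
  have "\<exists>q\<ge>0. q \<le> 1 \<and> (1 - \<theta>) * (1 + q\<^sup>2) - 2 * \<theta> * q = 0"
    using \<theta> by (intro IVT2') (auto intro!: continuous_intros)
  then obtain q where q: "0 \<le> q" "q \<le> 1" and eq: "(1 - \<theta>) * (1 + q\<^sup>2) = 2 * \<theta> * q"
    by auto
  \<comment> \<open>At \<open>q = 1\<close> the equation would force
    \<open>\<theta> = 1 / 2\<close>.\<close>
  have "q \<noteq> 1" using eq \<theta> by auto
  with q have "q < 1" by simp
  then have q2: "q\<^sup>2 < 1" using q by (simp add: abs_square_less_1)
  define u where "u = (\<lambda>n::int. q ^ nat \<bar>n\<bar>)"
  define a where "a = (1 + q\<^sup>2) / (1 - q\<^sup>2)"
  define b where "b = 2 * (1 - q)\<^sup>2 / (1 - q\<^sup>2)"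
  have sums: "((\<lambda>n. (u n)\<^sup>2) has_sum a) UNIV" "((\<lambda>n. (D u n)\<^sup>2) has_sum b) UNIV"
    using geometric_sequence_sums[OF q(1) \<open>q < 1\<close>] by (simp_all add: u_def a_def b_def)
  then have "u \<in> l2"
    by (auto simp: l2_def summable_on_def)
  have pos: "0 < a" "0 < b"
    using q2 \<open>q < 1\<close> by (auto simp: a_def b_def intro!: divide_pos_pos add_pos_nonneg)
  have "\<theta> * (2 * (1 - q)\<^sup>2) = 2 * (2 * \<theta> - 1) * (1 + q\<^sup>2)"
    using eq by algebra
  then have ab: "\<theta> * b = 2 * (2 * \<theta> - 1) * a"
    unfolding a_def b_def times_divide_eq_right by (simp only:)
  have "4 * a - b = 2 * (1 + q)\<^sup>2 / (1 - q\<^sup>2)"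
    unfolding a_def b_def by (simp add: diff_divide_distrib[symmetric] power2_eq_square algebra_simps)
  \<comment> \<open>The product is 4 for every \<open>q\<close>, so the limiting bound equals
    \<open>1 = (u 0)\<^sup>2\<close>. The choice of \<open>q\<close> only places
    \<open>b / a\<close> at the maximiser.\<close>
  then have "(4 * a - b) * b = (2 * ((1 + q) * (1 - q)) / (1 - q\<^sup>2))\<^sup>2"
    unfolding b_def by (simp add: power2_eq_square)
  also have "(1 + q) * (1 - q) = 1 - q\<^sup>2"
    by (simp add: power2_eq_square algebra_simps)
  also have "2 * (1 - q\<^sup>2) / (1 - q\<^sup>2) = 2"
    using q2 by (intro nonzero_mult_div_cancel_right) simp
  finally have "(4 * a - b) * b = 2\<^sup>2" .
  then have "K1 \<theta> * (a powr \<theta> * b powr (1 - \<theta>)) = 1"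
    using limit_bound_eq_K1[OF \<theta>(1) pos(1) ab] by (simp add: mult.assoc)
  also have "1 \<le> C * (a powr \<theta> * b powr (1 - \<theta>))"
    using C \<open>u \<in> l2\<close> sums pos
    by (auto simp: sequence_ineq_iff infsumI rpow_pos u_def mult.assoc dest!: bspec[of _ _ u])
  finally show ?thesis
    using pos by simp
qed

subsection \<open>Integrals\<close>

lemma weight_pos:
  fixes t x :: real
  assumes "0 < t"
  shows "0 < t * (sin x)\<^sup>2 + (cos x)\<^sup>2 / t"
proof (cases "sin x = 0")
  case True
  then have "(cos x)\<^sup>2 = 1" using sin_cos_squared_add[of x] by simp
  then show ?thesis using assms True by simp
qed (use assms in \<open>auto intro!: add_pos_nonneg\<close>)

text \<open>The antiderivative \<open>F\<close> increases from \<open>- pi\<close> to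
  \<open>pi\<close> whatever \<open>t\<close> is. It is written with \<open>cot\<close> because
  \<open>tan (x / 2)\<close> has a pole at \<open>pi\<close>, inside the interval.\<close>

lemma integral_inverse_weight:
  fixes t :: real
  assumes t: "0 < t"
  defines "f \<equiv> \<lambda>x. 1 / (t * (sin (x / 2))\<^sup>2 + (cos (x / 2))\<^sup>2 / t)"
  shows "integrable M f" "(\<integral>x. f x \<partial>M) = 2 * pi"
proof -
  define F where "F = (\<lambda>x. - 2 * arctan (cot (x / 2) / t))"
  note w = weight_pos[OF t]
  have sin: "0 < sin (x / 2)" if "0 < x" "x < 2 * pi" for x :: real
    using that by (intro sin_gt_zero) auto
  have F': "(F has_real_derivative f x) (at x)" if "0 < x" "x < 2 * pi" for x
  proof -
    define s c where "s = sin (x / 2)" and "c = cos (x / 2)"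
    have s: "0 < s" using sin[OF that] by (simp add: s_def)
    have w': "t * s\<^sup>2 + c\<^sup>2 / t > 0" using w by (simp add: s_def c_def)
    have "((\<lambda>x. cot (x / 2)) has_real_derivative - inverse (s\<^sup>2) * (1 / 2)) (at x)"
      unfolding s_def using s
      by (intro DERIV_chain2[where f = cot and g = "\<lambda>x. x / 2"] DERIV_cot)
        (auto simp: s_def intro!: derivative_eq_intros)
    then have "(F has_real_derivative
        - 2 * (inverse (1 + (cot (x / 2) / t)\<^sup>2) * (- inverse (s\<^sup>2) * (1 / 2) / t))) (at x)"
      unfolding F_def using t
      by (auto intro!: derivative_eq_intros DERIV_chain2[OF DERIV_arctan])
    also have "cot (x / 2) = c / s" by (simp add: cot_def s_def c_def)
    also have "- 2 * (inverse (1 + (c / s / t)\<^sup>2) * (- inverse (s\<^sup>2) * (1 / 2) / t))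
        = 1 / ((1 + (c / s / t)\<^sup>2) * (s\<^sup>2 * t))"
      by (simp add: divide_simps)
    also have "(1 + (c / s / t)\<^sup>2) * (s\<^sup>2 * t) = t * s\<^sup>2 + c\<^sup>2 / t"
      using s t by (simp add: field_simps power2_eq_square)
    finally show ?thesis by (simp add: f_def s_def c_def)
  qed
  have cont: "isCont f x" for x
    unfolding f_def using w[of "x / 2"] t by (intro continuous_intros) auto
  have ev0: "eventually (\<lambda>x. 0 < x \<and> x < 2 * pi) (at_right (0::real))"
    unfolding eventually_at_right_field by (rule exI[of _ "2 * pi"]) auto
  have ev1: "eventually (\<lambda>x. 0 < x \<and> x < 2 * pi) (at_left (2 * pi))"
    unfolding eventually_at_left_field by (rule exI[of _ 0]) auto
  \<comment> \<open>At both ends \<open>sin (x / 2)\<close> tends to 0 from above, while the cosine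
    tends to 1 at 0 and to -1 at \<open>2 * pi\<close>.\<close>
  have "LIM x at_right 0. cos (x / 2) / t * inverse (sin (x / 2)) :> at_top"
  proof (rule filterlim_tendsto_pos_mult_at_top)
    show "((\<lambda>x. cos (x / 2) / t) \<longlongrightarrow> cos (0 / 2) / t) (at_right 0)"
      using t by (intro tendsto_intros) auto
    have "((\<lambda>x::real. sin (x / 2)) \<longlongrightarrow> sin (0 / 2)) (at_right 0)"
      by (intro tendsto_intros) auto
    then show "LIM x at_right 0. inverse (sin (x / 2)) :> (at_top :: real filter)"
      by (intro filterlim_inverse_at_top) (auto intro: eventually_mono[OF ev0] sin)
  qed (use t in auto)
  then have "LIM x at_right 0. cot (x / 2) / t :> at_top"
    by (simp add: cot_def field_simps)
  then have "((\<lambda>x. arctan (cot (x / 2) / t)) \<longlongrightarrow> pi / 2) (at_right 0)"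
    by (rule filterlim_compose[OF tendsto_arctan_at_top])
  then have A: "(F \<longlongrightarrow> - 2 * (pi / 2)) (at_right 0)"
    unfolding F_def by (intro tendsto_intros)
  have "LIM x at_left (2 * pi). cos (x / 2) / t * inverse (sin (x / 2)) :> at_bot"
  proof (rule filterlim_tendsto_neg_mult_at_bot)
    show "((\<lambda>x. cos (x / 2) / t) \<longlongrightarrow> cos (2 * pi / 2) / t) (at_left (2 * pi))"
      using t by (intro tendsto_intros) auto
    have "((\<lambda>x::real. sin (x / 2)) \<longlongrightarrow> sin (2 * pi / 2)) (at_left (2 * pi))"
      by (intro tendsto_intros) auto
    then show "LIM x at_left (2 * pi). inverse (sin (x / 2)) :> (at_top :: real filter)"
      by (intro filterlim_inverse_at_top) (auto intro: eventually_mono[OF ev1] sin)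
  qed (use t in auto)
  then have "LIM x at_left (2 * pi). cot (x / 2) / t :> at_bot"
    by (simp add: cot_def field_simps)
  then have "((\<lambda>x. arctan (cot (x / 2) / t)) \<longlongrightarrow> - (pi / 2)) (at_left (2 * pi))"
    by (rule filterlim_compose[OF tendsto_arctan_at_bot])
  then have B: "(F \<longlongrightarrow> - 2 * - (pi / 2)) (at_left (2 * pi))"
    unfolding F_def by (intro tendsto_intros)
  have eint: "einterval (ereal 0) (ereal (2 * pi)) = {0<..<2 * pi}"
    by (auto simp: einterval_def)
  have FTC: "set_integrable lborel (einterval (ereal 0) (ereal (2 * pi))) f"
    "(LBINT x=ereal 0..ereal (2 * pi). f x) = - 2 * - (pi / 2) - (- 2 * (pi / 2))"
    by (rule interval_integral_FTC_nonneg[where F = F];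
        use F' cont A B w in \<open>auto simp: f_def ereal_tendsto_simps1 less_imp_le\<close>)+
  \<comment> \<open>Borel measurability carries the integral over from \<open>lborel\<close> to its
    completion, on which \<open>M\<close> is built.\<close>
  have meas: "(\<lambda>x. indicator {0<..<2 * pi} x *\<^sub>R f x) \<in> borel_measurable lborel"
    unfolding f_def by measurable
  show "integrable M f"
    using FTC(1) meas unfolding eint set_integrable_def
    by (simp add: integrable_restrict_space integrable_completion)
  show "(\<integral>x. f x \<partial>M) = 2 * pi"
    using FTC(2) meas
    by (simp add: interval_lebesgue_integral_def eint set_lebesgue_integral_def
        integral_restrict_space integral_completion)
qed

text \<open>Integrate \<open>(g \<surd>w - k / \<surd>w)\<^sup>2 \<ge> 0\<close> for the weight \<open>w = t sin\<^sup>2(x/2) + cos\<^sup>2(x/2) / t\<close>.\<close>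

lemma integral_bound:
  assumes "g \<in> L2"
  defines "a \<equiv> (\<integral>x. (g x)\<^sup>2 \<partial>M)" and "b \<equiv> (\<integral>x. 4 * (sin (x / 2))\<^sup>2 * (g x)\<^sup>2 \<partial>M)"
  shows "0 \<le> a" "0 \<le> b" "b \<le> 4 * a" "(\<integral>x. g x \<partial>M)\<^sup>2 \<le> pi * sqrt ((4 * a - b) * b)"
proof -
  have g: "g \<in> borel_measurable M" and g2: "integrable M (\<lambda>x. (g x)\<^sup>2)"
    using assms(1) by (auto simp: L2_def)
  have trig: "(\<lambda>x. sin (x / 2)) \<in> borel_measurable M"
    by (auto intro!: continuous_imp_measurable_on_sets_lebesgue continuous_intros)
  \<comment> \<open>On a space of finite measure, square integrable functions are
    integrable.\<close>
  have int_g: "integrable M g"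
  proof (rule Bochner_Integration.integrable_bound)
    show "integrable M (\<lambda>x. (g x)\<^sup>2 + 1)"
      using g2 by (intro Bochner_Integration.integrable_add finite_measure.integrable_const)
        (auto intro!: finite_measureI simp: emeasure_restrict_space)
    have "\<bar>y\<bar> \<le> y\<^sup>2 + 1" for y :: real
      using sum_squares_bound[of "\<bar>y\<bar>" 1] by (simp add: power2_eq_square)
    then show "AE x in M. norm (g x) \<le> norm ((g x)\<^sup>2 + 1)"
      by simp
  qed (rule g)
  have int_s: "integrable M (\<lambda>x. 4 * (sin (x / 2))\<^sup>2 * (g x)\<^sup>2)"
  proof (rule Bochner_Integration.integrable_bound)
    show "integrable M (\<lambda>x. 4 * (g x)\<^sup>2)"
      using g2 by simp
    have "(sin (x / 2))\<^sup>2 * (g x)\<^sup>2 \<le> 1 * (g x)\<^sup>2" for x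
      by (intro mult_right_mono) (auto simp: abs_square_le_1)
    then show "AE x in M. norm (4 * (sin (x / 2))\<^sup>2 * (g x)\<^sup>2) \<le> norm (4 * (g x)\<^sup>2)"
      by (simp add: mult.assoc)
  qed (use g trig in measurable)
  have c_eq: "4 * (cos (x / 2))\<^sup>2 * (g x)\<^sup>2 = 4 * (g x)\<^sup>2 - 4 * (sin (x / 2))\<^sup>2 * (g x)\<^sup>2" for x
    by (simp add: cos_squared_eq algebra_simps)
  have int_c: "integrable M (\<lambda>x. 4 * (cos (x / 2))\<^sup>2 * (g x)\<^sup>2)"
    unfolding c_eq using g2 int_s by (intro Bochner_Integration.integrable_diff) simp_all
  have c: "(\<integral>x. 4 * (cos (x / 2))\<^sup>2 * (g x)\<^sup>2 \<partial>M) = 4 * a - b"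
    unfolding c_eq a_def b_def using g2 int_s by (subst Bochner_Integration.integral_diff) simp_all
  show "0 \<le> a" "0 \<le> b"
    by (simp_all add: a_def b_def)
  have "0 \<le> (\<integral>x. 4 * (cos (x / 2))\<^sup>2 * (g x)\<^sup>2 \<partial>M)"
    by simp
  then show ba: "b \<le> 4 * a"
    unfolding c by simp
  define I where "I = (\<integral>x. g x \<partial>M)"
  have "2 * I\<^sup>2 / pi \<le> t * b + (4 * a - b) / t" if t: "0 < t" for t
  proof -
    define w where "w = (\<lambda>x. t * (sin (x / 2))\<^sup>2 + (cos (x / 2))\<^sup>2 / t)"
    \<comment> \<open>This \<open>k\<close> minimises \<open>2 * pi * k\<^sup>2 - 2 * k * I\<close>,
      the part of the integrated square that depends on \<open>k\<close>.\<close>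
    define k where "k = I / (2 * pi)"
    have inv: "integrable M (\<lambda>x. 1 / w x)" "(\<integral>x. 1 / w x \<partial>M) = 2 * pi"
      unfolding w_def by (rule integral_inverse_weight[OF t])+
    have w: "0 < w x" for x
      using weight_pos[OF t] by (simp add: w_def)
    \<comment> \<open>The square is then expanded into four functions with known integrals:
      \<open>b\<close>, \<open>4 * a - b\<close>, \<open>I\<close> and
      \<open>2 * pi\<close>.\<close>
    have "0 \<le> (\<integral>x. (g x * w x - k)\<^sup>2 / w x \<partial>M)"
      using w by (intro integral_nonneg_AE) (simp add: less_imp_le)
    also have "(\<integral>x. (g x * w x - k)\<^sup>2 / w x \<partial>M)
        = (\<integral>x. t / 4 * (4 * (sin (x / 2))\<^sup>2 * (g x)\<^sup>2) + 1 / (4 * t) * (4 * (cos (x / 2))\<^sup>2 * (g x)\<^sup>2)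
            - 2 * k * g x + k\<^sup>2 * (1 / w x) \<partial>M)"
    proof (rule Bochner_Integration.integral_cong[OF refl])
      fix x
      have "(g x * w x - k)\<^sup>2 / w x = (g x)\<^sup>2 * w x - 2 * k * g x + k\<^sup>2 * (1 / w x)"
        using w[of x] by (simp add: field_simps power2_eq_square)
      also have "(g x)\<^sup>2 * w x = t / 4 * (4 * (sin (x / 2))\<^sup>2 * (g x)\<^sup>2)
          + 1 / (4 * t) * (4 * (cos (x / 2))\<^sup>2 * (g x)\<^sup>2)"
        by (simp add: w_def algebra_simps)
      finally show "(g x * w x - k)\<^sup>2 / w x = t / 4 * (4 * (sin (x / 2))\<^sup>2 * (g x)\<^sup>2)
          + 1 / (4 * t) * (4 * (cos (x / 2))\<^sup>2 * (g x)\<^sup>2) - 2 * k * g x + k\<^sup>2 * (1 / w x)" .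
    qed
    also have "\<dots> = t / 4 * b + 1 / (4 * t) * (4 * a - b) - 2 * k * I + k\<^sup>2 * (2 * pi)"
      using int_g int_s int_c inv(1)
      by (simp only: Bochner_Integration.integral_add Bochner_Integration.integral_diff
          Bochner_Integration.integrable_add Bochner_Integration.integrable_diff
          integral_mult_right_zero integrable_mult_right inv(2) c I_def[symmetric] b_def[symmetric])
    also have "\<dots> = (t * b + (4 * a - b) / t - 2 * I\<^sup>2 / pi) / 4"
      using t by (simp add: k_def field_simps power2_eq_square)
    finally show ?thesis by simp
  qed
  then have "2 * I\<^sup>2 / pi \<le> 2 * sqrt (b * (4 * a - b))"
    using \<open>0 \<le> b\<close> ba by (intro le_geometric_mean_of_weighted_sums) auto
  then show "(\<integral>x. g x \<partial>M)\<^sup>2 \<le> pi * sqrt ((4 * a - b) * b)"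
    by (simp add: I_def field_simps)
qed

lemma integral_ineq_K1:
  assumes "1 / 2 < \<theta>" "\<theta> \<le> 1"
  shows "integral_ineq \<theta> (2 * pi * K1 \<theta>)"
  unfolding integral_ineq_def
proof
  fix g assume "g \<in> L2"
  note ib = integral_bound[OF this]
  have "X \<le> 2 * pi * k * p * q" if "X \<le> pi * s" "1 / 2 * s \<le> k * p * q" for X s k p q :: real
  proof -
    have "pi * s \<le> pi * (2 * (k * p * q))"
      using that(2) by (intro mult_left_mono) simp_all
    also have "\<dots> = 2 * pi * k * p * q" by simp
    finally show ?thesis using that(1) by linarith
  qed
  from this[OF ib(4) limit_bound_le_K1[OF assms ib(1-3)]]
  show "(\<integral>x. g x \<partial>M)\<^sup>2 \<le> 2 * pi * K1 \<theta> * rpow (\<integral>x. (g x)\<^sup>2 \<partial>M) \<theta>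
      * rpow (\<integral>x. 4 * (sin (x / 2))\<^sup>2 * (g x)\<^sup>2 \<partial>M) (1 - \<theta>)" .
qed

lemma limit_integral_ineq: "limit_integral_ineq"
  unfolding limit_integral_ineq_def
proof (intro ballI impI)
  fix g assume "g \<in> L2"
  note ib = integral_bound[OF this]
  show "(\<integral>x. g x \<partial>M)\<^sup>2
      \<le> pi * sqrt (4 - (\<integral>x. 4 * (sin (x / 2))\<^sup>2 * (g x)\<^sup>2 \<partial>M) / (\<integral>x. (g x)\<^sup>2 \<partial>M))
        * rpow (\<integral>x. (g x)\<^sup>2 \<partial>M) (1 / 2) * rpow (\<integral>x. 4 * (sin (x / 2))\<^sup>2 * (g x)\<^sup>2 \<partial>M) (1 / 2)"
    using ib(4) unfolding rpow_half[OF ib(1)] rpow_half[OF ib(2)] sqrt_diff_divide_mult[OF ib(1-3), symmetric]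
    by (simp only: mult.assoc)
qed

theorem theorem6p1:
  shows "(\<forall>\<theta>::real. 1 / 2 < \<theta> \<and> \<theta> \<le> 1 \<longrightarrow>
            sequence_ineq \<theta> (K1 \<theta>) \<and>
            (\<forall>C. sequence_ineq \<theta> C \<longrightarrow> K1 \<theta> \<le> C) \<and>
            (sequence_ineq \<theta> (K1 \<theta>) \<longleftrightarrow> integral_ineq \<theta> (2 * pi * K1 \<theta>)) \<and>
            integral_ineq \<theta> (2 * pi * K1 \<theta>)) \<and>
         limit_sequence_ineq \<and>
         (limit_sequence_ineq \<longleftrightarrow> limit_integral_ineq) \<and>
         limit_integral_ineq"
  using sequence_ineq_K1 sequence_ineq_sharp integral_ineq_K1
    limit_sequence_ineq limit_integral_ineq by blast

end
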